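(* Let $X$ be a finite simplicial complex on a vertex set $V$. Then $X$ is a quota complex, i.e. there exist $n$, a weight function $\hat w:V\to\mathbb{R}_+^n$ and a quota $\hat q\in\mathbb{R}_+^n$ such that $X=X[\hat w:\hat q]$. Furthermore, the weights and the quota can be chosen to have positive integer coordinates, and these coordinates can be assumed to be all distinct (that is, the numbers $w_j(v)$, for $v\in V$ and $1\le j\le n$, together with $q_j$, for $1\le j\le n$, are pairwise distinct).
   Context: $\mathbb{R}_+$ denotes the positive reals. For $\hat w=(w_1,\dots,w_n):V\to\mathbb{R}_+^n$ and $\hat q=(q_1,\dots,q_n)\in\mathbb{R}_+^n$, the (vector valued) quota complex $X[\hat w:\hat q]$ is the simplicial complex whose faces are the nonempty finite subsets $\{v_0,\dots,v_k\}$ of $V$ (distinct vertices) such that $\sum_{i=0}^k w_j(v_i)<q_j$ for some $1\le j\le n$. The vertex set $V$ is finite. *)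

theory Defs
  imports Complex_Main
begin

text \<open>
  Faces are nonempty. Singletons \<open>{v}\<close> with \<open>v \<in> V\<close> are not required to be faces: this is the
  notion for which every quota complex with vertices in \<open>V\<close> is a simplicial complex on \<open>V\<close>, since
  \<open>{v}\<close> is not a face when \<open>w v j \<ge> q j\<close> for all \<open>j\<close>. Complexes containing all singletons are
  a special case.
\<close>

definition abstract_simplicial_complex :: "'a set \<Rightarrow> 'a set set \<Rightarrow> bool" where
  "abstract_simplicial_complex V X \<longleftrightarrow>
     (\<forall>F\<in>X. finite F \<and> F \<noteq> {} \<and> F \<subseteq> V) \<and>
     (\<forall>F\<in>X. \<forall>G. G \<noteq> {} \<and> G \<subseteq> F \<longrightarrow> G \<in> X)"

text \<open>
  A vector in \<open>\<real>\<^sup>n\<close> is a function \<open>nat \<Rightarrow> real\<close> of which only the values at the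
  indices \<open>{1..n}\<close> matter, because \<open>n\<close> is quantified existentially.
\<close>

definition quota_complex ::
    "'a set \<Rightarrow> nat \<Rightarrow> ('a \<Rightarrow> nat \<Rightarrow> real) \<Rightarrow> (nat \<Rightarrow> real) \<Rightarrow> 'a set set" where
  "quota_complex V n w q =
     {F. finite F \<and> F \<noteq> {} \<and> F \<subseteq> V \<and> (\<exists>j\<in>{1..n}. (\<Sum>v\<in>F. w v j) < q j)}"

definition weights_and_quota ::
    "'a set \<Rightarrow> nat \<Rightarrow> ('a \<Rightarrow> nat \<Rightarrow> real) \<Rightarrow> (nat \<Rightarrow> real) \<Rightarrow> bool" where
  "weights_and_quota V n w q \<longleftrightarrow>
     1 \<le> n \<and> (\<forall>v\<in>V. \<forall>j\<in>{1..n}. 0 < w v j) \<and> (\<forall>j\<in>{1..n}. 0 < q j)"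

definition integer_coordinates ::
    "'a set \<Rightarrow> nat \<Rightarrow> ('a \<Rightarrow> nat \<Rightarrow> real) \<Rightarrow> (nat \<Rightarrow> real) \<Rightarrow> bool" where
  "integer_coordinates V n w q \<longleftrightarrow>
     (\<forall>v\<in>V. \<forall>j\<in>{1..n}. w v j \<in> \<int>) \<and> (\<forall>j\<in>{1..n}. q j \<in> \<int>)"

definition distinct_coordinates ::
    "'a set \<Rightarrow> nat \<Rightarrow> ('a \<Rightarrow> nat \<Rightarrow> real) \<Rightarrow> (nat \<Rightarrow> real) \<Rightarrow> bool" where
  "distinct_coordinates V n w q \<longleftrightarrow>
     inj_on (\<lambda>(v, j). w v j) (V \<times> {1..n}) \<and>
     inj_on q {1..n} \<and>
     (\<forall>v\<in>V. \<forall>i\<in>{1..n}. \<forall>j\<in>{1..n}. w v i \<noteq> q j)"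

lemma abstract_simplicial_complex_quota_complex:
  assumes "weights_and_quota V n w q"
  shows "abstract_simplicial_complex V (quota_complex V n w q)"
  unfolding abstract_simplicial_complex_def
proof (intro conjI ballI allI impI)
  fix F G assume F: "F \<in> quota_complex V n w q" and G: "G \<noteq> {} \<and> G \<subseteq> F"
  from F have fin: "finite F" and FV: "F \<subseteq> V" by (simp_all add: quota_complex_def)
  from F have "\<exists>j\<in>{1..n}. (\<Sum>v\<in>F. w v j) < q j" by (simp add: quota_complex_def)
  then obtain j where j: "j \<in> {1..n}" "(\<Sum>v\<in>F. w v j) < q j" by (elim bexE)
  have nonneg: "0 \<le> w v j" if "v \<in> F - G" for v
  proof -
    from that FV have "v \<in> V" by blast
    with assms j(1) have "0 < w v j" by (simp add: weights_and_quota_def)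
    then show ?thesis by simp
  qed
  have "(\<Sum>v\<in>G. w v j) \<le> (\<Sum>v\<in>F. w v j)"
    by (rule sum_mono2[OF fin conjunct2[OF G] nonneg])
  with j(2) have less: "(\<Sum>v\<in>G. w v j) < q j" by linarith
  have "finite G" "G \<subseteq> V" using G FV finite_subset[OF conjunct2[OF G] fin] by auto
  moreover have "\<exists>j\<in>{1..n}. (\<Sum>v\<in>G. w v j) < q j" using less j(1) by (rule bexI)
  ultimately show "G \<in> quota_complex V n w q" using G by (simp add: quota_complex_def)
qed (auto simp: quota_complex_def)

end

(* Index the coordinates by the faces of X together with the empty set, which keeps n positive
   when X is empty. In the coordinate of F the vertices of F get small weights, whose total is
   below the quota, and every other vertex alone has weight above the quota, so the j-th inequality
   holds for G exactly when G is contained in F. Distinctness comes from adding to the weights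
   distinct small integers, whose overall sum S separates the small weights, the quotas
   S + 1, ..., S + n and the large weights. *)
theory Submission imports Defs begin

lemma finite_abstract_simplicial_complex:
  assumes "finite V" "abstract_simplicial_complex V X"
  shows "finite X"
proof (rule finite_subset)
  show "X \<subseteq> Pow V" using assms(2) by (auto simp: abstract_simplicial_complex_def)
qed (simp add: assms(1))

text \<open>A face covers itself, and downward closure gives the converse. The inserted empty set
  covers no nonempty \<open>G\<close>.\<close>

lemma abstract_simplicial_complex_covered_iff:
  assumes "abstract_simplicial_complex V X"
  shows "G \<in> X \<longleftrightarrow> G \<noteq> {} \<and> (\<exists>F\<in>insert {} X. G \<subseteq> F)"
  using assms unfolding abstract_simplicial_complex_def by blast

text \<open>The family \<open>F\<close> is arbitrary, possibly with repetitions: distinctness comes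
  from labels indexed by pairs of vertex and coordinate.\<close>

lemma ex_separating_integer_weights:
  fixes V :: "'a set" and F :: "nat \<Rightarrow> 'a set"
  assumes V: "finite V" and n: "1 \<le> n"
  obtains w q where "weights_and_quota V n w q" "integer_coordinates V n w q"
    "distinct_coordinates V n w q"
    "\<And>G j. G \<subseteq> V \<Longrightarrow> j \<in> {1..n} \<Longrightarrow> (\<Sum>v\<in>G. w v j) < q j \<longleftrightarrow> G \<subseteq> F j"
proof -
  define P where "P = V \<times> {1..n}"
  have finP: "finite P" using V by (simp add: P_def)
  obtain d :: "'a \<times> nat \<Rightarrow> nat" where d: "inj_on d P"
    using finite_imp_inj_to_nat_seg[OF finP] by blast
  \<comment> \<open>The successor makes small weights positive and large ones strictly exceed
    \<open>S + n\<close>.\<close>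
  define e where "e p = Suc (d p)" for p
  have e: "inj_on e P" using d by (auto simp: e_def inj_on_def)
  define S where "S = sum e P"
  \<comment> \<open>The quotas will be \<open>S + j\<close>, so the offset \<open>S + n\<close> is
    at least every quota.\<close>
  define u where "u v j = (if v \<in> F j then e (v, j) else S + n + e (v, j))" for v j
  have e_pos: "0 < e p" for p by (simp add: e_def)
  have e_le: "e p \<le> S" if "p \<in> P" for p
    unfolding S_def using finP that by (simp add: member_le_sum)
  have cover: "(\<Sum>v\<in>G. u v j) < S + j \<longleftrightarrow> G \<subseteq> F j" if G: "G \<subseteq> V" and j: "j \<in> {1..n}" for G j
  proof
    have finG: "finite G" using G V by (rule finite_subset)
    assume less: "(\<Sum>v\<in>G. u v j) < S + j"
    show "G \<subseteq> F j"
    proof (rule subsetI, rule ccontr)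
      fix v assume v: "v \<in> G" "v \<notin> F j"
      have "u v j \<le> (\<Sum>v\<in>G. u v j)" using member_le_sum[of v G "\<lambda>v. u v j"] finG v(1) by simp
      with less j v(2) show False by (simp add: u_def)
    qed
  next
    assume "G \<subseteq> F j"
    then have "(\<Sum>v\<in>G. u v j) = (\<Sum>v\<in>G. e (v, j))"
      by (intro sum.cong) (auto simp: u_def)
    \<comment> \<open>The labels used form a partial sum of \<open>S\<close>; the bound becomes
      strict because \<open>j\<close> is at least 1.\<close>
    also have "\<dots> = sum e ((\<lambda>v. (v, j)) ` G)"
      by (subst sum.reindex) (auto simp: inj_on_def)
    also have "\<dots> \<le> S"
      unfolding S_def using finP G j by (intro sum_mono2) (auto simp: P_def)
    finally show "(\<Sum>v\<in>G. u v j) < S + j" using j by simp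
  qed
  have inj_u: "inj_on (\<lambda>(v, j). u v j) P"
  proof (rule inj_onI, clarify)
    fix v i x j assume P: "(v, i) \<in> P" "(x, j) \<in> P" and eq: "u v i = u x j"
    \<comment> \<open>A small weight is at most \<open>S\<close> and a large one exceeds
      \<open>S + n\<close>, so both weights have the same offset, which cancels.\<close>
    have "e (v, i) = e (x, j)"
      using eq e_le[OF P(1)] e_le[OF P(2)] e_pos[of "(v, i)"] e_pos[of "(x, j)"]
      by (auto simp: u_def split: if_splits)
    then have "(v, i) = (x, j)" using inj_onD[OF e _ P] by blast
    then show "v = x \<and> i = j" by simp
  qed
  have u_neq: "u v i \<noteq> S + j" if "v \<in> V" "i \<in> {1..n}" "j \<in> {1..n}" for v i j
    using that e_le[of "(v, i)"] e_pos[of "(v, i)"] by (auto simp: u_def P_def)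
  show thesis
  proof (rule that[of "\<lambda>v j. real (u v j)" "\<lambda>j. real (S + j)"])
    show "weights_and_quota V n (\<lambda>v j. real (u v j)) (\<lambda>j. real (S + j))"
      using n e_pos by (auto simp: weights_and_quota_def u_def)
    show "integer_coordinates V n (\<lambda>v j. real (u v j)) (\<lambda>j. real (S + j))"
      by (simp add: integer_coordinates_def)
    show "distinct_coordinates V n (\<lambda>v j. real (u v j)) (\<lambda>j. real (S + j))"
      unfolding distinct_coordinates_def
    proof (intro conjI)
      show "inj_on (\<lambda>(v, j). real (u v j)) (V \<times> {1..n})"
        using inj_u unfolding inj_on_def P_def split_beta of_nat_eq_iff .
      show "inj_on (\<lambda>j. real (S + j)) {1..n}" by (simp add: inj_on_def)
      show "\<forall>v\<in>V. \<forall>i\<in>{1..n}. \<forall>j\<in>{1..n}. real (u v i) \<noteq> real (S + j)"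
        unfolding of_nat_eq_iff using u_neq by blast
    qed
    show "(\<Sum>v\<in>G. real (u v j)) < real (S + j) \<longleftrightarrow> G \<subseteq> F j"
      if "G \<subseteq> V" "j \<in> {1..n}" for G j
      using cover[OF that] by (simp only: of_nat_sum [symmetric] of_nat_less_iff)
  qed
qed

theorem theoremB1:
  fixes V :: "'a set" and X :: "'a set set"
  assumes "finite V"
    and "abstract_simplicial_complex V X"
  shows "(\<exists>n w q. weights_and_quota V n w q \<and> X = quota_complex V n w q) \<and>
         (\<exists>n w q. weights_and_quota V n w q \<and> integer_coordinates V n w q \<and>
                  distinct_coordinates V n w q \<and> X = quota_complex V n w q)"
proof -
  have finX: "finite X" using assms by (rule finite_abstract_simplicial_complex)
  define n where "n = card (insert {} X)"
  have n: "1 \<le> n" unfolding n_def One_nat_def Suc_le_eq card_gt_0_iff using finX by simp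
  obtain F where F: "bij_betw F {1..n} (insert {} X)"
    using ex_bij_betw_nat_finite_1[of "insert {} X"] finX unfolding n_def by blast
  obtain w q where wq: "weights_and_quota V n w q" "integer_coordinates V n w q"
      "distinct_coordinates V n w q"
    and cover: "\<And>G j. G \<subseteq> V \<Longrightarrow> j \<in> {1..n} \<Longrightarrow> (\<Sum>v\<in>G. w v j) < q j \<longleftrightarrow> G \<subseteq> F j"
    using ex_separating_integer_weights[OF assms(1) n, of F] by blast
  have "G \<in> X \<longleftrightarrow> G \<in> quota_complex V n w q" for G
  \<comment> \<open>The covering criterion holds only for subsets of \<open>V\<close>; any other
    \<open>G\<close> lies in neither complex.\<close>
  proof (cases "G \<subseteq> V")
    case True
    have "G \<in> X \<longleftrightarrow> G \<noteq> {} \<and> (\<exists>j\<in>{1..n}. G \<subseteq> F j)"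
      unfolding abstract_simplicial_complex_covered_iff[OF assms(2)]
        bij_betw_imp_surj_on[OF F, symmetric] by simp
    with True show ?thesis
      using finite_subset[OF True assms(1)] cover[OF True] by (auto simp: quota_complex_def)
  next
    case False
    then show ?thesis
      using assms(2) by (auto simp: abstract_simplicial_complex_def quota_complex_def)
  qed
  then have "X = quota_complex V n w q" by blast
  with wq show ?thesis by blast
qed

end
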